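(* For $n\in\mathbb N_0$, the quantity $$\sum_{\lambda\in \mathcal D(n)}\ell_1(\lambda) - \sum_{\lambda\in \mathcal O(n)}\ell_1(\lambda)$$ is non-negative except for $n=2$ and $n=4$, in which case it equals $-1$.
   Context: $\mathbb N_0=\{0,1,2,\dots\}$. A partition $\lambda=(\lambda_1\ge\lambda_2\ge\dots\ge\lambda_\ell)$ of $n$ is a non-increasing sequence of positive integers (parts) with sum $n$; $\ell(\lambda)$ is its number of parts, and we set $\lambda_k=0$ for $k>\ell(\lambda)$. $\mathcal O(n)$ is the set of partitions of $n$ into odd parts, and $\mathcal D(n)$ is the set of partitions of $n$ into distinct parts. $\ell_1(\lambda)$ denotes the number of parts $\lambda_i$ of $\lambda$ ($1\le i\le \ell(\lambda)$) with $\lambda_i-\lambda_{i+1}=1$. *)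

theory Defs
  imports Main
begin

definition partitions :: "nat \<Rightarrow> nat list set" where
  "partitions n = {xs. sorted_wrt (\<ge>) xs \<and> (\<forall>x\<in>set xs. x > 0) \<and> sum_list xs = n}"

definition odd_partitions :: "nat \<Rightarrow> nat list set" where
  "odd_partitions n = {xs \<in> partitions n. \<forall>x\<in>set xs. odd x}"

definition distinct_partitions :: "nat \<Rightarrow> nat list set" where
  "distinct_partitions n = {xs \<in> partitions n. distinct xs}"

text \<open>Parts are numbered from 1, and \<open>part xs k = 0\<close> beyond the length; the value at
  \<open>k = 0\<close> has no meaning.\<close>

definition part :: "nat list \<Rightarrow> nat \<Rightarrow> nat" where
  "part xs k = (if k \<le> length xs then xs ! (k - 1) else 0)"

text \<open>The last part is included, so it is counted exactly when it equals 1. The truncated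
  subtraction is harmless, as the parts are non-increasing.\<close>

definition ell1 :: "nat list \<Rightarrow> nat" where
  "ell1 xs = card {i \<in> {1..length xs}. part xs i - part xs (i + 1) = 1}"

text \<open>Sums over these sets are sums over finite sets.\<close>

lemma finite_partitions: "finite (partitions n)"
proof (rule finite_subset)
  have "length xs \<le> sum_list xs" if "\<forall>x\<in>set xs. x > 0" for xs :: "nat list"
    using that by (induction xs) (auto simp: Suc_le_eq)
  then show "partitions n \<subseteq> {xs. set xs \<subseteq> {..n} \<and> length xs \<le> n}"
    by (auto simp: partitions_def member_le_sum_list)
  show "finite {xs. set xs \<subseteq> {..n} \<and> length xs \<le> n}"
    by (rule finite_lists_length_le) simp
qed

lemma finite_odd_partitions: "finite (odd_partitions n)"
  by (simp add: odd_partitions_def finite_partitions)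

lemma finite_distinct_partitions: "finite (distinct_partitions n)"
  by (simp add: distinct_partitions_def finite_partitions)

end

theory Submission
  imports Defs "HOL-Library.Nat_Bijection" "HOL-Library.Multiset"
begin

text \<open>
  For every partition \<open>\<lambda>\<close>, the number \<open>\<ell>\<^sub>1(\<lambda>)\<close> counts the values \<open>k\<close> occurring in \<open>\<lambda>\<close> for which
  \<open>k = 1\<close> or \<open>k - 1\<close> also occurs (\<open>ell1_conv_values\<close>): only the last copy of \<open>k\<close> is followed by a
  different part, and that part is the largest value below \<open>k\<close>, or 0 if there is
  none. This makes both sums in the theorem cardinalities.

  In a partition into odd parts no two values are consecutive, so \<open>\<ell>\<^sub>1\<close> only detects whether 1 is a
  part. Removing one such part shows that the sum over \<open>\<O>(n)\<close> is at most \<open>|\<O>(n - 1)|\<close>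
  (\<open>sum_ell1_odd_partitions_le\<close>), and Glaisher's map \<open>\<O> \<rightarrow> \<D>\<close> bounds this by \<open>|\<D>(n - 1)|\<close>
  (\<open>card_odd_partitions_le\<close>).

  The sum over \<open>\<D>(n)\<close> counts the pairs \<open>(\<mu>, k)\<close> with \<open>\<mu> \<in> \<D>(n)\<close>, \<open>k \<in> \<mu>\<close>, and either \<open>k = 1\<close> or
  \<open>k - 1 \<in> \<mu>\<close>. It remains to encode each \<open>\<lambda> \<in> \<D>(n - 1)\<close> injectively by such a pair (\<open>unmark_surj\<close>).
  If \<open>1 \<notin> \<lambda>\<close>, add the part 1 and mark it. If \<open>1 \<in> \<lambda>\<close>, remove it and let \<open>x \<ge> 2\<close> be the smallest
  remaining part; two units are to be added.
  \<^item> If \<open>x\<close> is odd, then \<open>x + 2 = k + (k - 1)\<close> for some \<open>k \<le> x\<close>: replace \<open>x\<close> by \<open>k, k - 1\<close> and mark \<open>k \<ge> 3\<close>.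
  \<^item> If \<open>x \<ge> 4\<close> is even, then \<open>x + 2 = k + (k - 1) + 1\<close>: replace \<open>x\<close> by \<open>k, k - 1, 1\<close> and mark \<open>k \<ge> 3\<close>.
  \<^item> If \<open>x = 2\<close>, add the part 1, enlarge the largest part by 1, and mark 2.

  The mark and the presence of 1 tell the cases apart, and each case can be undone. The construction
  breaks down only if nothing is left after removing 1, or nothing but the part 2, which means
  \<open>\<lambda> = (1)\<close> or \<open>\<lambda> = (2, 1)\<close>, that is \<open>n = 2\<close> or \<open>n = 4\<close>. These are the exceptional values, settled
  by enumeration.
\<close>

section \<open>Counting values instead of positions\<close>

lemma part_antimono:
  assumes "sorted_wrt (\<ge>) xs" "1 \<le> i" "i \<le> j"
  shows "part xs j \<le> part xs i"
proof (cases "j \<le> length xs \<and> i < j")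
  case True
  then have "i - 1 < j - 1" "j - 1 < length xs" using assms by auto
  then have "xs ! (j - 1) \<le> xs ! (i - 1)" using assms(1) by (auto simp: sorted_wrt_iff_nth_less)
  then show ?thesis using True by (simp add: Defs.part_def)
qed (use assms in \<open>auto simp: Defs.part_def\<close>)

lemma set_conv_part: "set xs = part xs ` {1..length xs}"
proof -
  have "part xs ` {1..length xs} = (\<lambda>i. part xs (Suc i)) ` {..<length xs}"
    by (simp only: image_Suc_lessThan[symmetric] image_image)
  also have "\<dots> = (!) xs ` {..<length xs}"
    by (rule image_cong) (simp_all add: Defs.part_def)
  also have "\<dots> = set xs"
    by (auto simp: set_conv_nth)
  finally show ?thesis by simp
qed

lemma ell1_conv_values:
  assumes "xs \<in> partitions n"
  shows "ell1 xs = card {k \<in> set xs. k = 1 \<or> k - 1 \<in> set xs}"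
proof -
  have srt: "sorted_wrt (\<ge>) xs" and pos: "\<And>x. x \<in> set xs \<Longrightarrow> x > 0"
    using assms by (auto simp: partitions_def)
  let ?I = "{i \<in> {1..length xs}. part xs i - part xs (i + 1) = 1}"
  let ?K = "{k \<in> set xs. k = 1 \<or> k - 1 \<in> set xs}"
  have "inj_on (part xs) ?I"
  proof (rule linorder_inj_onI')
    fix i j assume "i \<in> ?I" "j \<in> ?I" "i < j"
    then have "part xs j \<le> part xs (i + 1)" using part_antimono[OF srt, of "i+1" j] by simp
    then show "part xs i \<noteq> part xs j" using \<open>i \<in> ?I\<close> by auto
  qed
  moreover have "part xs ` ?I = ?K"
  proof (intro equalityI subsetI)
    fix k assume "k \<in> part xs ` ?I"
    then obtain i where i: "i \<in> {1..length xs}" "k = part xs i" "part xs i - part xs (i+1) = 1"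
      by auto
    then have "k \<in> set xs" by (auto simp: set_conv_part)
    moreover have "k = 1 \<or> k - 1 \<in> set xs"
    proof (cases "i + 1 \<le> length xs")
      case True
      then have "part xs (i+1) \<in> set xs" by (auto simp: set_conv_part)
      moreover have "k - 1 = part xs (i+1)" using i by linarith
      ultimately show ?thesis by simp
    next
      case False
      then have "part xs (i+1) = 0" by (simp add: Defs.part_def)
      then show ?thesis using i by simp
    qed
    ultimately show "k \<in> ?K" by simp
  next
    fix k assume k: "k \<in> ?K"
    then have "k > 0" using pos by auto
    let ?J = "{j \<in> {1..length xs}. part xs j = k}"
    define i where "i = Max ?J"
    have "k \<in> part xs ` {1..length xs}" using k by (simp add: set_conv_part)
    then have "?J \<noteq> {}" by blast
    then have "i \<in> ?J" unfolding i_def by (intro Max_in) auto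
    then have i: "i \<in> {1..length xs}" "part xs i = k" by auto
    have "part xs (i+1) \<noteq> k"
    proof
      assume *: "part xs (i+1) = k"
      then have "i + 1 \<in> ?J" using \<open>k > 0\<close> by (auto simp: Defs.part_def split: if_splits)
      then have "i + 1 \<le> i" unfolding i_def by (intro Max_ge) auto
      then show False by simp
    qed
    then have less: "part xs (i+1) < k" using part_antimono[OF srt, of i "i+1"] i by simp
    have "k - 1 \<le> part xs (i+1)"
    proof (cases "k = 1")
      case False
      then obtain j where j: "j \<in> {1..length xs}" "part xs j = k - 1"
        using k by (auto simp: set_conv_part)
      have "i + 1 \<le> j"
      proof (rule ccontr)
        assume "\<not> i + 1 \<le> j"
        then have "k \<le> k - 1" using part_antimono[OF srt, of j i] i j by simp
        then show False using \<open>k > 0\<close> by simp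
      qed
      then show ?thesis using part_antimono[OF srt, of "i+1" j] j by simp
    qed auto
    then have "part xs i - part xs (i+1) = 1" using less i by linarith
    then have "i \<in> ?I" using i(1) by simp
    then show "k \<in> part xs ` ?I" using i(2)[symmetric] by (rule rev_image_eqI)
  qed
  ultimately have "card ?K = card ?I" using card_image by fastforce
  then show ?thesis by (simp only: ell1_def)
qed

section \<open>Distinct partitions as sets\<close>

definition distinct_part_sets :: "nat \<Rightarrow> nat set set" where
  "distinct_part_sets n = {A. finite A \<and> 0 \<notin> A \<and> \<Sum>A = n}"

lemma bij_betw_set_distinct_partitions:
  "bij_betw set (distinct_partitions n) (distinct_part_sets n)"
proof (rule bij_betw_byWitness[where f' = "\<lambda>A. rev (sorted_list_of_set A)"])
  show "\<forall>xs\<in>distinct_partitions n. rev (sorted_list_of_set (set xs)) = xs"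
  proof
    fix xs assume "xs \<in> distinct_partitions n"
    then have "distinct xs" "sorted (rev xs)"
      by (auto simp: distinct_partitions_def partitions_def sorted_wrt_rev)
    then have "sorted_list_of_set (set (rev xs)) = rev xs"
      by (intro sorted_list_of_set.idem_if_sorted_distinct) auto
    then show "rev (sorted_list_of_set (set xs)) = xs" by simp
  qed
  show "\<forall>A\<in>distinct_part_sets n. set (rev (sorted_list_of_set A)) = A"
    by (auto simp: distinct_part_sets_def)
  show "set ` distinct_partitions n \<subseteq> distinct_part_sets n"
    by (force simp: distinct_partitions_def partitions_def distinct_part_sets_def
        distinct_sum_list_conv_Sum)
  show "(\<lambda>A. rev (sorted_list_of_set A)) ` distinct_part_sets n \<subseteq> distinct_partitions n"
  proof
    fix xs assume "xs \<in> (\<lambda>A. rev (sorted_list_of_set A)) ` distinct_part_sets n"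
    then obtain A where A: "finite A" "0 \<notin> A" "\<Sum>A = n" "xs = rev (sorted_list_of_set A)"
      by (auto simp: distinct_part_sets_def)
    then have "sum_list xs = n"
      by (simp add: distinct_sum_list_conv_Sum sum_list_rev)
    moreover have "sorted_wrt (\<ge>) xs" using A by (simp add: sorted_wrt_rev)
    moreover have "\<forall>x\<in>set xs. x > 0" using A by (metis gr0I set_rev set_sorted_list_of_set)
    ultimately show "xs \<in> distinct_partitions n"
      using A by (auto simp: distinct_partitions_def partitions_def)
  qed
qed

lemma finite_distinct_part_sets: "finite (distinct_part_sets n)"
  using bij_betw_finite[OF bij_betw_set_distinct_partitions] finite_distinct_partitions by blast

section \<open>Odd partitions\<close>

text \<open>Glaisher's map: the copies of an odd part \<open>d\<close> are merged into parts \<open>d * 2 ^ i\<close> according to the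
  binary expansion of their number.\<close>

definition glaisher :: "nat list \<Rightarrow> nat set" where
  "glaisher xs = (\<lambda>(d, i). d * 2 ^ i) ` (SIGMA d:set xs. set_decode (count_list xs d))"

lemma odd_times_power2_inject:
  fixes d e :: nat
  assumes "odd d" "odd e"
  shows "d * 2 ^ i = e * 2 ^ j \<longleftrightarrow> d = e \<and> i = j"
proof
  have aux: "i = j" if "i \<le> j" "d * 2 ^ i = e * 2 ^ j" "odd d" for d e i j :: nat
  proof (rule ccontr)
    assume "i \<noteq> j"
    then have "j = i + Suc (j - i - 1)" using that(1) by simp
    then have "d * 2 ^ i = (e * 2 ^ Suc (j - i - 1)) * 2 ^ i"
      using that(2) by (metis mult.assoc mult.commute power_add)
    then have "d = e * 2 ^ Suc (j - i - 1)" by simp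
    then show False using that(3) by simp
  qed
  assume *: "d * 2 ^ i = e * 2 ^ j"
  then have "i = j" using aux[of i j d e] aux[of j i e d] assms by (cases i j rule: le_cases) (simp_all add: *)
  then show "d = e \<and> i = j" using * by simp
qed auto

lemma glaisher_in_distinct_part_sets:
  assumes "xs \<in> odd_partitions n"
  shows "glaisher xs \<in> distinct_part_sets n"
proof -
  have odd: "\<And>d. d \<in> set xs \<Longrightarrow> odd d" and sum: "sum_list xs = n"
    using assms by (auto simp: odd_partitions_def partitions_def)
  let ?S = "SIGMA d:set xs. set_decode (count_list xs d)"
  have inj: "inj_on (\<lambda>(d, i). d * 2 ^ i) ?S"
    by (rule inj_onI) (clarsimp simp: odd_times_power2_inject odd)
  have "\<Sum>(glaisher xs) = (\<Sum>(d, i)\<in>?S. d * 2 ^ i)"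
    unfolding glaisher_def by (subst sum.reindex[OF inj]) (simp add: case_prod_unfold)
  also have "\<dots> = (\<Sum>d\<in>set xs. \<Sum>i\<in>set_decode (count_list xs d). d * 2 ^ i)"
    by (subst sum.Sigma) auto
  also have "\<dots> = (\<Sum>d\<in>set xs. count_list xs d * d)"
  proof (rule sum.cong[OF refl])
    fix d
    have "(\<Sum>i\<in>set_decode (count_list xs d). 2 ^ i) = count_list xs d"
      using set_decode_inverse[of "count_list xs d"] by (simp add: set_encode_def)
    then show "(\<Sum>i\<in>set_decode (count_list xs d). d * 2 ^ i) = count_list xs d * d"
      by (simp add: sum_distrib_left[symmetric])
  qed
  also have "\<dots> = n"
    using sum_list_map_eq_sum_count[of "\<lambda>x. x" xs] sum by simp
  finally have "\<Sum>(glaisher xs) = n" .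
  moreover have "finite (glaisher xs)" unfolding glaisher_def by auto
  moreover have "0 \<notin> glaisher xs" using odd by (fastforce simp: glaisher_def)
  ultimately show ?thesis by (simp add: distinct_part_sets_def)
qed

text \<open>As \<open>m = d * 2 ^ i\<close> with \<open>d\<close> odd determines \<open>d\<close> and \<open>i\<close>, the binary digits of every multiplicity
  can be read off the image.\<close>

lemma inj_on_glaisher: "inj_on glaisher (odd_partitions n)"
proof (rule inj_onI)
  have dec: "set_decode (count_list xs d) = {i. d * 2 ^ i \<in> glaisher xs}"
    if "xs \<in> odd_partitions n" "odd d" for xs d
  proof -
    have odd: "\<And>d. d \<in> set xs \<Longrightarrow> odd d" using that by (auto simp: odd_partitions_def)
    \<comment> \<open>A multiplicity 0 has no binary digits, so \<open>d\<close> need not be assumed to be a part.\<close>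
    have "d \<in> set xs" if "i \<in> set_decode (count_list xs d)" for i
      using that by (cases "d \<in> set xs") (auto simp: count_list_0_iff)
    then show ?thesis
      by (auto simp: glaisher_def image_iff odd_times_power2_inject \<open>odd d\<close> odd)
  qed
  fix xs ys assume xs: "xs \<in> odd_partitions n" and ys: "ys \<in> odd_partitions n"
    and eq: "glaisher xs = glaisher ys"
  have "count_list xs d = count_list ys d" for d
  proof (cases "odd d")
    case True
    then have "set_decode (count_list xs d) = set_decode (count_list ys d)"
      using dec xs ys eq by simp
    then show ?thesis by (metis set_decode_inverse)
  next
    case False
    then have "d \<notin> set xs" "d \<notin> set ys" using xs ys by (auto simp: odd_partitions_def)
    then show ?thesis by (simp add: count_list_0_iff)
  qed
  then have "mset (rev xs) = mset (rev ys)" by (intro multiset_eqI) (simp add: count_mset)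
  moreover have "sorted (rev xs)" "sorted (rev ys)"
    using xs ys by (auto simp: odd_partitions_def partitions_def sorted_wrt_rev)
  ultimately have "rev xs = rev ys" by (metis properties_for_sort)
  then show "xs = ys" by simp
qed

text \<open>The half of Euler's identity \<open>|\<O>(n)| = |\<D>(n)|\<close> that follows from the injectivity of Glaisher's map.\<close>

lemma card_odd_partitions_le: "card (odd_partitions n) \<le> card (distinct_part_sets n)"
  by (rule card_inj_on_le[OF inj_on_glaisher _ finite_distinct_part_sets])
    (auto intro: glaisher_in_distinct_part_sets)

lemma ell1_odd_partition:
  assumes "xs \<in> odd_partitions n"
  shows "ell1 xs = (if 1 \<in> set xs then 1 else 0)"
proof -
  have odd: "odd x" if "x \<in> set xs" for x using that assms by (auto simp: odd_partitions_def)
  have "k - 1 \<notin> set xs" if "k \<in> set xs" for k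
    using odd[OF that] odd[of "k - 1"] by fastforce
  then have "{k \<in> set xs. k = 1 \<or> k - 1 \<in> set xs} = (if 1 \<in> set xs then {1} else {})" by auto
  moreover have "xs \<in> partitions n" using assms by (simp add: odd_partitions_def)
  ultimately show ?thesis by (simp add: ell1_conv_values)
qed

text \<open>A part 1 stands at the end of the list, so \<open>butlast\<close> removes it and can be undone.\<close>

lemma sum_ell1_odd_partitions_le:
  "(\<Sum>xs\<in>odd_partitions (Suc n). ell1 xs) \<le> card (odd_partitions n)"
proof -
  let ?O = "{xs \<in> odd_partitions (Suc n). 1 \<in> set xs}"
  have "(\<Sum>xs\<in>odd_partitions (Suc n). ell1 xs)
      = (\<Sum>xs\<in>odd_partitions (Suc n). if 1 \<in> set xs then 1 else 0)"
    by (rule sum.cong[OF refl], rule ell1_odd_partition)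
  also have "\<dots> = card ?O"
    by (simp add: sum.If_cases finite_odd_partitions Int_def)
  also have "\<dots> \<le> card (odd_partitions n)"
  proof (rule card_inj_on_le[where f = butlast])
    have last: "xs = butlast xs @ [1]" if "xs \<in> ?O" for xs
    proof -
      have "xs \<noteq> []" using that by auto
      then obtain ys y where xs: "xs = ys @ [y]" by (metis append_butlast_last_id)
      have "y \<le> 1" "y > 0" using that
        by (auto simp: xs odd_partitions_def partitions_def sorted_wrt_append)
      then show ?thesis using xs by simp
    qed
    show "inj_on butlast ?O" by (rule inj_onI) (metis last)
    show "butlast ` ?O \<subseteq> odd_partitions n"
    proof
      fix ys assume "ys \<in> butlast ` ?O"
      then obtain xs where xs: "xs \<in> ?O" "ys = butlast xs" by blast
      then have "ys @ [1] \<in> odd_partitions (Suc n)" using last[OF xs(1)] by simp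
      then show "ys \<in> odd_partitions n"
        by (auto simp: odd_partitions_def partitions_def sorted_wrt_append)
    qed
    show "finite (odd_partitions n)" by (rule finite_odd_partitions)
  qed
  finally show ?thesis .
qed

section \<open>Distinct partitions with a marked part\<close>

definition marked :: "nat \<Rightarrow> (nat set \<times> nat) set" where
  "marked n = (SIGMA A:distinct_part_sets n. {k \<in> A. k = 1 \<or> k - 1 \<in> A})"

lemma sum_ell1_distinct_partitions: "(\<Sum>xs\<in>distinct_partitions n. ell1 xs) = card (marked n)"
proof -
  have "(\<Sum>xs\<in>distinct_partitions n. ell1 xs)
      = (\<Sum>xs\<in>distinct_partitions n. card {k \<in> set xs. k = 1 \<or> k - 1 \<in> set xs})"
    by (rule sum.cong[OF refl], rule ell1_conv_values[of _ n]) (simp add: distinct_partitions_def)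
  also have "\<dots> = (\<Sum>A\<in>distinct_part_sets n. card {k \<in> A. k = 1 \<or> k - 1 \<in> A})"
    by (rule sum.reindex_bij_betw[OF bij_betw_set_distinct_partitions])
  also have "\<dots> = card (marked n)"
    unfolding marked_def
    by (rule card_SigmaI[symmetric, OF finite_distinct_part_sets]) (auto simp: distinct_part_sets_def)
  finally show ?thesis .
qed

lemma finite_marked: "finite (marked n)"
  unfolding marked_def using finite_distinct_part_sets
  by (auto simp: distinct_part_sets_def intro!: finite_SigmaI)

text \<open>The decoding of a marked partition of \<open>n\<close> into a distinct partition of \<open>n - 1\<close>, one branch for each
  way of encoding. For \<open>k \<ge> 3\<close> the numbers \<open>2 * k - 2\<close> and \<open>2 * k - 3\<close> are the even and the odd \<open>x\<close>
  recovered from \<open>x + 2 = k + (k - 1) + 1\<close> and \<open>x + 2 = k + (k - 1)\<close>. On pairs that encode nothing the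
  value is arbitrary.\<close>

fun unmark :: "nat set \<times> nat \<Rightarrow> nat set" where
  "unmark (A, k) =
    (if k = 1 then A - {1}
     else if k = 2 then let C = A - {1, 2}; m = Max C in insert 1 (insert 2 (insert (m - 1) (C - {m})))
     else if 1 \<in> A then insert 1 (insert (2 * k - 2) (A - {k, k - 1, 1}))
     else insert 1 (insert (2 * k - 3) (A - {k, k - 1})))"

text \<open>New parts never collide
  with old ones: all parts other than 1 and \<open>x\<close> exceed \<open>x \<ge> k\<close>, and the enlarged largest part stays
  the largest. The values 1 and 3 of \<open>n\<close> are excluded because \<open>{1}\<close> leaves no smallest part \<open>x\<close>, and
  \<open>{1, 2}\<close> leaves no part to enlarge besides \<open>x = 2\<close>.\<close>

lemma unmark_surj:
  assumes "n \<noteq> 1" "n \<noteq> 3"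
  shows "distinct_part_sets n \<subseteq> unmark ` marked (Suc n)"
proof
  fix A assume "A \<in> distinct_part_sets n"
  then have A: "finite A" "0 \<notin> A" "\<Sum>A = n" by (auto simp: distinct_part_sets_def)
  show "A \<in> unmark ` marked (Suc n)"
  proof (cases "1 \<in> A")
    case False
    then have "(insert 1 A, 1) \<in> marked (Suc n)"
      using A by (auto simp: marked_def distinct_part_sets_def)
    moreover have "unmark (insert 1 A, 1) = A" using False by simp
    ultimately show ?thesis by (metis imageI)
  next
    case True
    define B where "B = A - {1}"
    have B: "finite B" "0 \<notin> B" "1 \<notin> B" "A = insert 1 B" using A True by (auto simp: B_def)
    have sumB: "n = Suc (\<Sum>B)" using A B by simp
    then have "B \<noteq> {}" using assms by auto
    define x where "x = Min B"
    define C where "C = B - {x}"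
    have x: "x \<in> B" unfolding x_def using B \<open>B \<noteq> {}\<close> by simp
    have C: "finite C" "B = insert x C" "x \<notin> C" using B x by (auto simp: C_def)
    have xC: "x < y" if "y \<in> C" for y
      using that B C unfolding x_def by (metis C_def DiffD1 Min_le le_neq_implies_less x_def)
    have sumC: "n = Suc (x + \<Sum>C)" using sumB C by simp
    have "x \<ge> 2" using x B by (metis One_nat_def Suc_1 less_2_cases not_less)
    consider "x = 2" | "x \<ge> 3" "odd x" | "x \<ge> 4" "even x"
      using \<open>x \<ge> 2\<close> by (cases "x = 2"; cases "x = 3"; cases "odd x") auto
    then show ?thesis
    proof cases
      case 1
      have "C \<noteq> {}" using sumC assms 1 by auto
      define m where "m = Max C"
      define R where "R = C - {m}"
      have m: "m \<in> C" unfolding m_def using C \<open>C \<noteq> {}\<close> by simp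
      have R: "finite R" "C = insert m R" "m \<notin> R" using C m by (auto simp: R_def)
      have Rm: "y < m" if "y \<in> R" for y
        using that C R unfolding m_def by (metis Max_ge insertCI le_neq_implies_less m_def)
      have m2: "m > 2" using xC m 1 by auto
      have R2: "y > 2" if "y \<in> R" for y using xC that R 1 by auto
      have sR: "Suc m \<notin> R" "1 \<notin> R" "2 \<notin> R" "0 \<notin> R" using Rm R2 by fastforce+
      let ?A = "insert 1 (insert 2 (insert (Suc m) R))"
      have "\<Sum>?A = Suc n" using sR R m2 sumC 1 by simp
      then have "(?A, 2) \<in> marked (Suc n)"
        using R sR by (auto simp: marked_def distinct_part_sets_def)
      moreover have "unmark (?A, 2) = A"
      proof -
        have *: "?A - {1, 2} = insert (Suc m) R" using sR m2 by auto
        have "Max (insert (Suc m) R) = Suc m"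
          using R Rm by (intro Max_eqI) (auto simp: less_imp_le less_SucI)
        then show ?thesis using * sR B C R 1 by (simp add: Let_def)
      qed
      ultimately show ?thesis by (metis imageI)
    next
      case 2
      then obtain k where k: "x = 2 * k - 3" "k \<ge> 3"
        by (intro that[of "(x + 3) div 2"]) (auto elim!: oddE)
      let ?A = "insert k (insert (k - 1) C)"
      have kC: "k \<notin> C" "k - 1 \<notin> C" "1 \<notin> C" "0 \<notin> C" using xC[of k] xC[of "k-1"] xC[of 1] xC[of 0] k by auto
      have "\<Sum>?A = Suc n" using kC C k sumC by simp
      then have "(?A, k) \<in> marked (Suc n)"
        using C kC k by (auto simp: marked_def distinct_part_sets_def)
      moreover have "unmark (?A, k) = A"
      proof -
        have "?A - {k, k - 1} = C" "1 \<notin> ?A" using kC k by auto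
        then show ?thesis using k B C by simp
      qed
      ultimately show ?thesis by (metis imageI)
    next
      case 3
      then obtain k where k: "x = 2 * k - 2" "k \<ge> 3"
        by (intro that[of "(x + 2) div 2"]) (auto elim!: evenE)
      let ?A = "insert 1 (insert k (insert (k - 1) C))"
      have kC: "k \<notin> C" "k - 1 \<notin> C" "1 \<notin> C" "0 \<notin> C" using xC[of k] xC[of "k-1"] xC[of 1] xC[of 0] k by auto
      have "\<Sum>?A = Suc n" using kC C k sumC by simp
      then have "(?A, k) \<in> marked (Suc n)"
        using C kC k by (auto simp: marked_def distinct_part_sets_def)
      moreover have "unmark (?A, k) = A"
      proof -
        have "?A - {k, k - 1, 1} = C" "1 \<in> ?A" using kC k by auto
        then show ?thesis using k B C by simp
      qed
      ultimately show ?thesis by (metis imageI)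
    qed
  qed
qed

lemma card_distinct_le_card_marked:
  assumes "n \<noteq> 1" "n \<noteq> 3"
  shows "card (distinct_part_sets n) \<le> card (marked (Suc n))"
  by (rule surj_card_le[OF finite_marked unmark_surj[OF assms]])

section \<open>The exceptional values\<close>

lemma partitions_rec:
  assumes "n > 0"
  shows "partitions n = (\<Union>x\<in>{1..n}. (#) x ` {xs \<in> partitions (n - x). \<forall>y\<in>set xs. y \<le> x})"
proof -
  have "xs \<in> partitions n \<longleftrightarrow>
      xs \<in> (\<Union>x\<in>{1..n}. (#) x ` {xs \<in> partitions (n - x). \<forall>y\<in>set xs. y \<le> x})" for xs
  proof (cases xs)
    case Nil
    then show ?thesis using assms by (auto simp: partitions_def)
  next
    case (Cons a ys)
    have "a # ys \<in> partitions n \<longleftrightarrow> a \<in> {1..n} \<and> ys \<in> partitions (n - a) \<and> (\<forall>y\<in>set ys. y \<le> a)"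
      by (auto simp: partitions_def)
    then show ?thesis by (auto simp: Cons)
  qed
  then show ?thesis by blast
qed

lemma partitions_small:
  "partitions 2 = {[2], [1, 1]}"
  "partitions 4 = {[4], [3, 1], [2, 2], [2, 1, 1], [1, 1, 1, 1]}"
proof -
  have ivl: "{1..1::nat} = {1}" "{1..2::nat} = {1, 2}" "{1..3::nat} = {1, 2, 3}"
    "{1..4::nat} = {1, 2, 3, 4}" by auto
  have 0: "partitions 0 = {[]}"
    by (auto simp: partitions_def neq_Nil_conv) (metis bot_nat_0.not_eq_extremum length_greater_0_conv nth_mem)
  have 1: "partitions (Suc 0) = {[1]}"
    unfolding One_nat_def[symmetric] by (subst partitions_rec, simp, unfold ivl) (auto simp: 0)
  show 2: "partitions 2 = {[2], [1, 1]}"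
    by (subst partitions_rec, simp, unfold ivl) (auto simp: 0 1)
  have 3: "partitions 3 = {[3], [2, 1], [1, 1, 1]}"
    by (subst partitions_rec, simp, unfold ivl) (auto simp: 0 1 2)
  show "partitions 4 = {[4], [3, 1], [2, 2], [2, 1, 1], [1, 1, 1, 1]}"
    by (subst partitions_rec, simp, unfold ivl) (auto simp: 0 1 2 3)
qed

lemma sum_ell1_difference_exceptional:
  assumes "n \<in> {2, 4}"
  shows "(\<Sum>xs\<in>distinct_partitions n. int (ell1 xs)) - (\<Sum>xs\<in>odd_partitions n. int (ell1 xs)) = -1"
proof -
  have filt: "{xs \<in> insert ys Y. P xs} = (if P ys then insert ys {xs \<in> Y. P xs} else {xs \<in> Y. P xs})"
    for ys :: "nat list" and Y P by auto
  have odd_partitions: "odd_partitions 2 = {[1, 1]}" "odd_partitions 4 = {[3, 1], [1, 1, 1, 1]}"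
    unfolding odd_partitions_def partitions_small filt by simp_all
  have distinct_partitions: "distinct_partitions 2 = {[2]}" "distinct_partitions 4 = {[4], [3, 1]}"
    unfolding distinct_partitions_def partitions_small filt by simp_all
  have ell1_distinct: "ell1 [2] = 0" "ell1 [4] = 0"
    using ell1_conv_values[of "[2]" 2] ell1_conv_values[of "[4]" 4] by (auto simp: partitions_small)
  have ell1_odd: "ell1 [1, 1] = 1" "ell1 [3, 1] = 1" "ell1 [1, 1, 1, 1] = 1"
    using odd_partitions ell1_odd_partition[of "[1, 1]" 2] ell1_odd_partition[of "[3, 1]" 4]
      ell1_odd_partition[of "[1, 1, 1, 1]" 4] by simp_all
  consider "n = 2" | "n = 4" using assms by blast
  then show ?thesis
  proof cases
    case 1
    show ?thesis
      unfolding 1 odd_partitions distinct_partitions by (simp add: ell1_distinct ell1_odd[simplified])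
  next
    case 2
    show ?thesis
      unfolding 2 odd_partitions distinct_partitions by (simp add: ell1_distinct ell1_odd[simplified])
  qed
qed

section \<open>The comparison\<close>

theorem theorem6p1:
  fixes n :: nat
  shows "(n \<notin> {2, 4} \<longrightarrow>
      (\<Sum>xs\<in>distinct_partitions n. int (ell1 xs)) - (\<Sum>xs\<in>odd_partitions n. int (ell1 xs)) \<ge> 0) \<and>
    (n \<in> {2, 4} \<longrightarrow>
      (\<Sum>xs\<in>distinct_partitions n. int (ell1 xs)) - (\<Sum>xs\<in>odd_partitions n. int (ell1 xs)) = -1)"
proof (intro conjI impI)
  assume n: "n \<notin> {2, 4}"
  have "(\<Sum>xs\<in>odd_partitions n. ell1 xs) \<le> (\<Sum>xs\<in>distinct_partitions n. ell1 xs)"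
  proof (cases n)
    case 0
    have "ell1 xs = 0" if "xs \<in> odd_partitions 0" for xs
      using that by (cases xs) (auto simp: odd_partitions_def partitions_def ell1_def)
    then show ?thesis using 0 by simp
  next
    case (Suc m)
    have "(\<Sum>xs\<in>odd_partitions n. ell1 xs) \<le> card (odd_partitions m)"
      unfolding Suc by (rule sum_ell1_odd_partitions_le)
    also have "\<dots> \<le> card (distinct_part_sets m)" by (rule card_odd_partitions_le)
    also have "\<dots> \<le> card (marked n)"
      unfolding Suc by (rule card_distinct_le_card_marked) (use n Suc in auto)
    also have "\<dots> = (\<Sum>xs\<in>distinct_partitions n. ell1 xs)"
      by (rule sum_ell1_distinct_partitions[symmetric])
    finally show ?thesis .
  qed
  then show "(\<Sum>xs\<in>distinct_partitions n. int (ell1 xs))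
      - (\<Sum>xs\<in>odd_partitions n. int (ell1 xs)) \<ge> 0"
    by (simp flip: of_nat_sum)
qed (rule sum_ell1_difference_exceptional)

end
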